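(* Let $A$ be an idiom and let $j$ be a spectral nucleus on $A$. For every interval $[a,b]\in\mathcal D_{\neg j}$ the following assertions hold: (1) $[a,b]$ is a complemented interval, i.e. for each $a\le x\le b$ there exists $a\le y\le b$ with $x\wedge y=a$ and $x\vee y=b$. (2) There exists $y\in[a,b]$ such that $[y,b]\in Sct(\mathcal D_j)$.
   Context: An idiom is a complete lattice $A$ (bottom $0$, top $1$) which is modular and upper-continuous: $a\wedge\bigvee X=\bigvee\{a\wedge x\mid x\in X\}$ for all $a\in A$ and all directed $X\subseteq A$. A nucleus on $A$ is a map $j\colon A\to A$ that is monotone, satisfies $a\le j(a)$, $j(a\wedge b)=j(a)\wedge j(b)$ and $j\circ j=j$. $N(A)$ is the set of all nuclei on $A$ ordered pointwise; it is a frame with bottom $id$. $\neg j$ denotes the pseudocomplement of $j$ in the frame $N(A)$ (the largest $k\in N(A)$ with $k\wedge j=id$). For $j\in N(A)$, $A_j=\{a\in A\mid j(a)=a\}$ with the induced order; $j$ is spectral if $A_j$ is a complemented lattice. For $a\le b$ the interval $[a,b]$ is $\{x\in A\mid a\le x\le b\}$. For $k\in N(A)$, $\mathcal D_k$ is the set of intervals $[a,b]$ with $b\le k(a)$. $Crt(\mathcal D_j)$ is the set of ($j$-critical) intervals $[a,b]$ such that for every $a\le x\le b$, $x=a$ or $[x,b]\in\mathcal D_j$. Put $soc_j(a)=\bigvee\{x\ge a\mid[a,x]\in Crt(\mathcal D_j)\}$. $Sct(\mathcal D_j)$, the set of $j$-semicritical intervals, consists of the intervals $[a,b]$ with $b\le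 soc_j(a)$. *)

theory Defs
  imports Main "HOL-Library.Lub_Glb"
begin

class idiom = complete_lattice +
  assumes modular: "a \<le> c \<Longrightarrow> sup a (inf b c) = inf (sup a b) c"
    and upper_continuous:
      "X \<noteq> {} \<Longrightarrow> (\<forall>x\<in>X. \<forall>y\<in>X. \<exists>z\<in>X. x \<le> z \<and> y \<le> z) \<Longrightarrow>
        inf a (Sup X) = Sup {inf a x | x. x \<in> X}"

definition nucleus :: "('a::idiom \<Rightarrow> 'a) \<Rightarrow> bool"
  where "nucleus j \<longleftrightarrow>
    mono j \<and> (\<forall>a. a \<le> j a) \<and> (\<forall>a b. j (inf a b) = inf (j a) (j b)) \<and> j \<circ> j = j"

text \<open>Nuclei are ordered pointwise, i.e. by the order on functions, and their binary meet is the
  pointwise one. The set of nuclei on an idiom is a frame, so the greatest element below exists.\<close>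

definition neg_nucleus :: "('a::idiom \<Rightarrow> 'a) \<Rightarrow> 'a \<Rightarrow> 'a"
  where "neg_nucleus j = (GREATEST k. nucleus k \<and> inf k j = id)"

definition fixed_points :: "('a \<Rightarrow> 'a) \<Rightarrow> 'a set"
  where "fixed_points j = {a. j a = a}"

text \<open>The set \<open>S\<close> carries the induced order. Meets, joins and bounds are those computed in \<open>S\<close>,
  which may differ from those of the ambient order.\<close>

definition complemented_lattice_on :: "'a::order set \<Rightarrow> bool"
  where "complemented_lattice_on S \<longleftrightarrow>
    (\<forall>x\<in>S. \<forall>y\<in>S. (\<exists>m. isGlb S {x, y} m) \<and> (\<exists>s. isLub S {x, y} s)) \<and>
    (\<exists>l u. isGlb S S l \<and> isLub S S u \<and>
      (\<forall>x\<in>S. \<exists>y\<in>S. isGlb S {x, y} l \<and> isLub S {x, y} u))"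

definition spectral :: "('a::idiom \<Rightarrow> 'a) \<Rightarrow> bool"
  where "spectral j \<longleftrightarrow> nucleus j \<and> complemented_lattice_on (fixed_points j)"

text \<open>Intervals are represented as the sets \<open>{a..b}\<close> with \<open>a \<le> b\<close>; such a set determines its
  endpoints.\<close>

definition nucleus_intervals :: "('a::idiom \<Rightarrow> 'a) \<Rightarrow> 'a set set"
  where "nucleus_intervals k = {{a..b} | a b. a \<le> b \<and> b \<le> k a}"

definition Crt :: "'a::idiom set set \<Rightarrow> 'a set set"
  where "Crt D = {{a..b} | a b. a \<le> b \<and> (\<forall>x\<in>{a..b}. x = a \<or> {x..b} \<in> D)}"

definition soc :: "('a::idiom \<Rightarrow> 'a) \<Rightarrow> 'a \<Rightarrow> 'a"
  where "soc j a = Sup {x. a \<le> x \<and> {a..x} \<in> Crt (nucleus_intervals j)}"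

text \<open>The collection of \<open>j\<close>-semicritical intervals.\<close>

definition Sct :: "('a::idiom \<Rightarrow> 'a) \<Rightarrow> 'a set set"
  where "Sct j = {{a..b} | a b. a \<le> b \<and> b \<le> soc j a}"

end

theory Submission
  imports Defs
begin

text \<open>
  Write \<open>n\<close> for the pseudocomplement of \<open>j\<close>, and let \<open>b \<le> n a\<close>. Every \<open>x\<close> in \<open>[a, n a]\<close> has
  \<open>n x = n a\<close>, so \<open>n \<and> j = id\<close> gives \<open>x = n a \<and> j x\<close>: the nucleus \<open>j\<close> is injective on \<open>[a, b]\<close>
  and the inverse is the meet with \<open>n a\<close> (\<open>meet_image_of_disjoint_nucleus\<close>). Complements can
  therefore be found in the quotient \<open>A\<^sub>j\<close> and pulled back. The quotient is complemented because
  \<open>j\<close> is spectral, and it inherits the modular law, so that each of its intervals is complemented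
  as well (\<open>spectral_relative_complement\<close>).

  This uses that \<open>n\<close> really is a nucleus with \<open>n \<and> j = id\<close>, that is, that the pseudocomplement
  exists. The trick is to drop idempotence at first. Consider all prenuclei \<open>p\<close>, that is, monotone,
  inflationary, meet-preserving maps, with \<open>p a \<and> j a \<le> a\<close> for all \<open>a\<close>. They include every
  nucleus disjoint from \<open>j\<close>. They are closed under composition, hence directed, and so their
  pointwise supremum \<open>s\<close> is again one of them by upper continuity. Then \<open>s \<circ> s\<close> is also one of
  them, so it lies below \<open>s\<close>: thus \<open>s\<close> is idempotent and is the greatest nucleus disjoint
  from \<open>j\<close> (\<open>ex_greatest_disjoint_nucleus\<close>).

  The second assertion holds for a degenerate reason: \<open>[b, b]\<close> is \<open>j\<close>-critical, so \<open>b \<le> soc\<^sub>j b\<close>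
  and \<open>y = b\<close> is a witness.
\<close>

section \<open>Existence of the pseudocomplement of a nucleus\<close>

definition prenuclei_disjoint_from :: "('a::idiom \<Rightarrow> 'a) \<Rightarrow> ('a \<Rightarrow> 'a) set"
  where "prenuclei_disjoint_from j = {p. mono p \<and> (\<forall>a. a \<le> p a) \<and>
    (\<forall>a b. p (inf a b) = inf (p a) (p b)) \<and> (\<forall>a. inf (p a) (j a) \<le> a)}"

lemma prenuclei_disjoint_fromD:
  assumes "p \<in> prenuclei_disjoint_from j"
  shows "mono p" "a \<le> p a" "p (inf a b) = inf (p a) (p b)" "inf (p a) (j a) \<le> a"
  using assms by (auto simp: prenuclei_disjoint_from_def)

lemma nucleusD:
  assumes "nucleus j"
  shows "mono j" "a \<le> j a" "j (inf a b) = inf (j a) (j b)" "j (j a) = j a"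
  using assms by (auto simp: nucleus_def fun_eq_iff)

text \<open>Closure under composition both makes these prenuclei directed, since \<open>p \<circ> q\<close> lies above \<open>p\<close>
  and \<open>q\<close>, and makes the largest of them idempotent.\<close>

lemma prenuclei_disjoint_from_comp:
  assumes j: "mono j"
    and p: "p \<in> prenuclei_disjoint_from j" and q: "q \<in> prenuclei_disjoint_from j"
  shows "p \<circ> q \<in> prenuclei_disjoint_from j"
proof -
  note P = prenuclei_disjoint_fromD[OF p] and Q = prenuclei_disjoint_fromD[OF q]
  have "inf (p (q a)) (j a) \<le> a" for a
  proof -
    have ja: "j a \<le> j (q a)" using monoD[OF j] Q(2) by blast
    have "inf (p (q a)) (j a) \<le> inf (p (q a)) (j (q a))" using ja by (simp add: le_infI2)
    also have "\<dots> \<le> q a" by (rule P(4))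
    finally have "inf (p (q a)) (j a) \<le> inf (q a) (j a)" by simp
    also have "\<dots> \<le> a" by (rule Q(4))
    finally show ?thesis .
  qed
  moreover have "mono (p \<circ> q)" using P(1) Q(1) by (auto simp: mono_def)
  moreover have "a \<le> p (q a)" for a using P(2) Q(2) order_trans by blast
  ultimately show ?thesis using P(3) Q(3) by (auto simp: prenuclei_disjoint_from_def)
qed

lemma prenuclei_disjoint_from_le_comp:
  assumes p: "p \<in> prenuclei_disjoint_from j" and q: "q \<in> prenuclei_disjoint_from j"
  shows "p a \<le> (p \<circ> q) a" "q a \<le> (p \<circ> q) a"
  using monoD[OF prenuclei_disjoint_fromD(1)[OF p]] prenuclei_disjoint_fromD(2)[OF p]
    prenuclei_disjoint_fromD(2)[OF q]
  by simp_all

text \<open>The form of upper continuity used below: meets distribute over the values at one point of the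
  directed family.\<close>

lemma inf_SUP_prenuclei:
  fixes j :: "'a::idiom \<Rightarrow> 'a"
  assumes j: "nucleus j"
  shows "inf c (SUP p\<in>prenuclei_disjoint_from j. p a) =
    (SUP p\<in>prenuclei_disjoint_from j. inf c (p a))"
proof -
  let ?P = "prenuclei_disjoint_from j"
  let ?X = "(\<lambda>p. p a) ` ?P"
  have "id \<in> ?P" by (auto simp: prenuclei_disjoint_from_def mono_def)
  then have ne: "?X \<noteq> {}" by blast
  have "\<exists>z\<in>?X. p a \<le> z \<and> q a \<le> z" if p: "p \<in> ?P" and q: "q \<in> ?P" for p q
    using prenuclei_disjoint_from_comp[OF nucleusD(1)[OF j] p q]
      prenuclei_disjoint_from_le_comp[OF p q] by blast
  then have dir: "\<forall>x\<in>?X. \<forall>y\<in>?X. \<exists>z\<in>?X. x \<le> z \<and> y \<le> z" by blast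
  have "{inf c x | x. x \<in> ?X} = (\<lambda>p. inf c (p a)) ` ?P" by blast
  then show ?thesis using upper_continuous[OF ne dir, of c] by simp
qed

text \<open>The pointwise supremum of the family preserves meets because \<open>s a \<and> s b\<close> is, by two uses of
  upper continuity, the supremum of all \<open>p a \<and> q b\<close>, and each of these is at most
  \<open>(p \<circ> q) a \<and> (p \<circ> q) b = (p \<circ> q) (a \<and> b)\<close>.\<close>

lemma ex_greatest_disjoint_nucleus:
  fixes j :: "'a::idiom \<Rightarrow> 'a"
  assumes j: "nucleus j"
  shows "\<exists>s. nucleus s \<and> inf s j = id \<and> (\<forall>k. nucleus k \<and> inf k j = id \<longrightarrow> k \<le> s)"
proof -
  let ?P = "prenuclei_disjoint_from j"
  define s where "s a = (SUP p\<in>?P. p a)" for a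
  have upper: "p a \<le> s a" if "p \<in> ?P" for p a
    unfolding s_def using that by (rule SUP_upper)
  have idP: "id \<in> ?P" by (auto simp: prenuclei_disjoint_from_def mono_def)
  have infl: "a \<le> s a" for a using upper[OF idP] by simp
  have mono: "mono s"
    unfolding s_def mono_def
    by (auto intro!: SUP_mono intro: monoD[OF prenuclei_disjoint_fromD(1)])
  have disj: "inf (s a) (j a) \<le> a" for a
  proof -
    have "inf (j a) (s a) = (SUP p\<in>?P. inf (j a) (p a))"
      unfolding s_def by (rule inf_SUP_prenuclei[OF j])
    also have "\<dots> \<le> a"
      by (intro SUP_least) (simp add: prenuclei_disjoint_fromD(4) inf_commute[of "j a"])
    finally show ?thesis by (simp add: inf_commute)
  qed
  have meet: "s (inf a b) = inf (s a) (s b)" for a b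
  proof (rule antisym)
    show "s (inf a b) \<le> inf (s a) (s b)" by (simp add: monoD[OF mono])
    have pq: "inf (q b) (p a) \<le> s (inf a b)" if p: "p \<in> ?P" and q: "q \<in> ?P" for p q
    proof -
      have "inf (q b) (p a) \<le> inf ((p \<circ> q) a) ((p \<circ> q) b)"
        using prenuclei_disjoint_from_le_comp(1)[OF p q, of a]
          prenuclei_disjoint_from_le_comp(2)[OF p q, of b]
        by (simp add: le_infI1 le_infI2)
      also have "\<dots> = (p \<circ> q) (inf a b)"
        by (rule prenuclei_disjoint_fromD(3)[OF
              prenuclei_disjoint_from_comp[OF nucleusD(1)[OF j] p q], symmetric])
      also have "\<dots> \<le> s (inf a b)"
        using prenuclei_disjoint_from_comp[OF nucleusD(1)[OF j] p q] by (rule upper)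
      finally show ?thesis .
    qed
    have "inf (s a) (q b) \<le> s (inf a b)" if q: "q \<in> ?P" for q
    proof -
      have "inf (q b) (s a) = (SUP p\<in>?P. inf (q b) (p a))"
        unfolding s_def by (rule inf_SUP_prenuclei[OF j])
      also have "\<dots> \<le> s (inf a b)" using q by (intro SUP_least pq)
      finally show ?thesis by (simp add: inf_commute)
    qed
    then have "(SUP q\<in>?P. inf (s a) (q b)) \<le> s (inf a b)" by (rule SUP_least)
    then show "inf (s a) (s b) \<le> s (inf a b)"
      using inf_SUP_prenuclei[OF j, of "s a" b] by (simp add: s_def)
  qed
  have sP: "s \<in> ?P"
    using mono infl meet disj by (simp add: prenuclei_disjoint_from_def)
  have "s (s a) = s a" for a
    using upper[OF prenuclei_disjoint_from_comp[OF nucleusD(1)[OF j] sP sP], of a] infl[of "s a"]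
    by (simp add: antisym)
  then have "nucleus s" using mono infl meet by (auto simp: nucleus_def)
  moreover have "inf s j = id"
    using disj infl nucleusD(2)[OF j] by (auto simp: fun_eq_iff intro!: antisym)
  moreover have "k \<le> s" if k: "nucleus k" "inf k j = id" for k
  proof -
    have "inf (k a) (j a) = a" for a using fun_cong[OF k(2), of a] by simp
    then have "k \<in> ?P"
      using nucleusD[OF k(1)] by (auto simp: prenuclei_disjoint_from_def)
    then show ?thesis by (auto simp: le_fun_def intro: upper)
  qed
  ultimately show ?thesis by blast
qed

lemma neg_nucleus_disjoint:
  fixes j :: "'a::idiom \<Rightarrow> 'a"
  assumes "nucleus j"
  shows "nucleus (neg_nucleus j)" "inf (neg_nucleus j) j = id"
proof -
  obtain s where "nucleus s \<and> inf s j = id"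
    and "\<And>k. nucleus k \<and> inf k j = id \<Longrightarrow> k \<le> s"
    using ex_greatest_disjoint_nucleus[OF assms] by blast
  then have "nucleus (neg_nucleus j) \<and> inf (neg_nucleus j) j = id"
    unfolding neg_nucleus_def by (rule GreatestI2_order)
  then show "nucleus (neg_nucleus j)" "inf (neg_nucleus j) j = id" by auto
qed

section \<open>Relative complements in the quotient of a spectral nucleus\<close>

lemma nucleus_sup_nucleus:
  assumes "nucleus j"
  shows "j (sup (j x) y) = j (sup x y)" "j (sup x (j y)) = j (sup x y)"
proof -
  note J = nucleusD[OF assms]
  have l: "j (sup (j u) v) = j (sup u v)" for u v
  proof (rule antisym)
    have "sup (j u) v \<le> j (sup u v)"
      using J(2)[of "sup u v"] monoD[OF J(1), of u "sup u v"] by auto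
    then show "j (sup (j u) v) \<le> j (sup u v)" using monoD[OF J(1)] J(4) by metis
    show "j (sup u v) \<le> j (sup (j u) v)" using J(2)[of u]
      by (intro monoD[OF J(1)]) (simp add: le_supI1)
  qed
  show "j (sup (j x) y) = j (sup x y)" by (rule l)
  show "j (sup x (j y)) = j (sup x y)" using l[of y x] by (simp add: sup_commute)
qed

text \<open>In a modular lattice with bottom and top, a complement \<open>w\<close> of \<open>q\<close> yields the complement
  \<open>(w \<and> r) \<or> p\<close> of \<open>q\<close> in \<open>[p, r]\<close>. The lemma says this for the fixed points of \<open>j\<close>, where
  joins are computed by applying \<open>j\<close> to the ambient join; modularity carries over since \<open>j\<close>
  preserves meets.\<close>

lemma spectral_relative_complement:
  fixes j :: "'a::idiom \<Rightarrow> 'a"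
  assumes spec: "spectral j" and pq: "p \<le> q" and qr: "q \<le> r"
    and fix_p: "j p = p" and fix_q: "j q = q" and fix_r: "j r = r"
  shows "\<exists>z. j z = z \<and> p \<le> z \<and> z \<le> r \<and> inf q z = p \<and> j (sup q z) = r"
proof -
  let ?S = "fixed_points j"
  have j: "nucleus j" using spec by (simp add: spectral_def)
  note J = nucleusD[OF j]
  have qS: "q \<in> ?S" using fix_q by (simp add: fixed_points_def)
  obtain l u where l: "isGlb ?S ?S l" and u: "isLub ?S ?S u"
    and compl: "\<forall>x\<in>?S. \<exists>y\<in>?S. isGlb ?S {x, y} l \<and> isLub ?S {x, y} u"
    using spec unfolding spectral_def complemented_lattice_on_def by blast
  obtain w where w: "w \<in> ?S" and glb: "isGlb ?S {q, w} l" and lub: "isLub ?S {q, w} u"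
    using compl qS by blast
  have fix_w: "j w = w" using w by (simp add: fixed_points_def)
  have meet: "inf q w \<le> p"
  proof -
    have "inf q w \<in> ?S" using J(3) fix_q fix_w by (simp add: fixed_points_def)
    then have "inf q w \<le> l"
      using glb by (auto simp: isGlb_def greatestP_def isLb_def setge_def setle_def)
    also have "l \<le> p"
      using l fix_p by (auto simp: isGlb_def greatestP_def isLb_def setge_def fixed_points_def)
    finally show ?thesis .
  qed
  have join: "r \<le> j (sup q w)"
  proof -
    have "q \<le> j (sup q w)" "w \<le> j (sup q w)"
      using J(2)[of "sup q w"] by simp_all
    then have "u \<le> j (sup q w)"
      using lub J(4)
      by (auto simp: isLub_def leastP_def isUb_def setle_def setge_def fixed_points_def)
    moreover have "r \<le> u"
      using u fix_r by (auto simp: isLub_def leastP_def isUb_def setle_def fixed_points_def)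
    ultimately show ?thesis by (rule order_trans[rotated])
  qed
  define z where "z = j (sup p (inf w r))"
  have "j z = z" by (simp add: z_def J(4))
  moreover have "p \<le> z" using J(2)[of "sup p (inf w r)"] by (simp add: z_def)
  moreover have "z \<le> r"
  proof -
    have "sup p (inf w r) \<le> r" using order_trans[OF pq qr] by simp
    then show ?thesis using monoD[OF J(1)] fix_r unfolding z_def by metis
  qed
  moreover have "inf q z = p"
  proof -
    have "inf q z = j (inf (sup p (inf w r)) q)"
      using J(3)[of "sup p (inf w r)" q] fix_q by (simp add: z_def inf_commute)
    also have "inf (sup p (inf w r)) q = sup p (inf (inf w r) q)"
      using modular[OF pq, of "inf w r"] by simp
    also have "\<dots> = p"
    proof -
      have "inf (inf w r) q \<le> inf q w" by (simp add: le_infI1)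
      then have "inf (inf w r) q \<le> p" using meet by (rule order_trans)
      then show ?thesis by (simp add: sup_absorb1)
    qed
    finally show ?thesis using fix_p by simp
  qed
  moreover have "j (sup q z) = r"
  proof -
    have "j (sup q z) = j (sup q (sup p (inf w r)))"
      by (simp add: z_def nucleus_sup_nucleus[OF j])
    also have "sup q (sup p (inf w r)) = sup q (inf w r)"
      using pq by (simp add: sup_assoc[symmetric] sup_absorb1)
    also have "\<dots> = inf (sup q w) r" using modular[OF qr] .
    also have "j \<dots> = inf (j (sup q w)) r" using J(3) fix_r by simp
    also have "\<dots> = r" using join by (simp add: inf_absorb2)
    finally show ?thesis .
  qed
  ultimately show ?thesis by blast
qed

section \<open>Intervals collapsed by the pseudocomplement\<close>

text \<open>On \<open>[a, n a]\<close> the value of \<open>n\<close> is constant, so there the identity \<open>n x \<and> j x = x\<close>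
  recovers \<open>x\<close> from \<open>j x\<close> by one fixed meet.\<close>

lemma meet_image_of_disjoint_nucleus:
  assumes n: "nucleus n" and disj: "inf n j = id" and x: "a \<le> x" "x \<le> n a"
  shows "inf (n a) (j x) = x"
proof -
  note N = nucleusD[OF n]
  have "n x = n a" using monoD[OF N(1) x(1)] monoD[OF N(1) x(2)] N(4) by (simp add: antisym)
  then show ?thesis using fun_cong[OF disj, of x] by simp
qed

text \<open>If \<open>z\<close> is the complement of \<open>j x\<close> in \<open>[j a, j b]\<close> within the quotient, then \<open>z \<and> b\<close> is a
  preimage of \<open>z\<close>. It complements \<open>x\<close>, because \<open>x \<or> (z \<and> b)\<close> and \<open>b\<close> have the same image under
  \<open>j\<close>, which is injective here.\<close>

lemma spectral_interval_complemented:
  fixes j :: "'a::idiom \<Rightarrow> 'a"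
  assumes spec: "spectral j" and n: "nucleus n" and disj: "inf n j = id"
    and b: "b \<le> n a" and x: "a \<le> x" "x \<le> b"
  shows "\<exists>y. a \<le> y \<and> y \<le> b \<and> inf x y = a \<and> sup x y = b"
proof -
  have j: "nucleus j" using spec by (simp add: spectral_def)
  note J = nucleusD[OF j]
  note recover = meet_image_of_disjoint_nucleus[OF n disj]
  obtain z where z: "j z = z" "j a \<le> z" "z \<le> j b" "inf (j x) z = j a" "j (sup (j x) z) = j b"
    using spectral_relative_complement[OF spec, of "j a" "j x" "j b"] monoD[OF J(1)] x J(4)
    by blast
  define y where "y = inf z b"
  have ay: "a \<le> y" using J(2)[of a] z(2) x by (auto simp: y_def)
  have yb: "y \<le> b" by (simp add: y_def)
  have "inf x y = a"
  proof (rule antisym)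
    have "inf x y \<le> inf (n a) (inf (j x) z)"
      using J(2)[of x] order_trans[OF x(2) b] by (simp add: y_def le_infI1 le_infI2)
    also have "\<dots> = a" using z(4) recover[of a a] nucleusD(2)[OF n] by simp
    finally show "inf x y \<le> a" .
    show "a \<le> inf x y" using x ay by simp
  qed
  moreover have "sup x y = b"
  proof -
    have "j y = z" using J(3) z(1,3) by (simp add: y_def inf_absorb1)
    then have "j (sup x y) = j b"
      using z(5) nucleus_sup_nucleus[OF j] by metis
    moreover have "a \<le> sup x y" "sup x y \<le> n a" using x ay order_trans[OF _ b] yb
      by (simp_all add: le_supI1)
    ultimately have "sup x y = inf (n a) (j b)" using recover[of a "sup x y"] by simp
    also have "\<dots> = b" using recover[of a b] order_trans[OF x] b by simp
    finally show ?thesis .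
  qed
  ultimately show ?thesis using ay yb by blast
qed

lemma singleton_in_Sct: "{b..b} \<in> Sct j"
proof -
  have "{b..b} \<in> Crt (nucleus_intervals j)"
    unfolding Crt_def by force
  then have "b \<le> soc j b" unfolding soc_def by (auto intro: Sup_upper)
  then show ?thesis unfolding Sct_def by blast
qed

lemma atLeastAtMost_in_nucleus_intervals_iff:
  "{a..b} \<in> nucleus_intervals k \<longleftrightarrow> a \<le> b \<and> b \<le> k a"
  by (auto simp: nucleus_intervals_def Icc_eq_Icc)

theorem proposition4p13:
  fixes j :: "'a::idiom \<Rightarrow> 'a" and a b :: 'a
  assumes "nucleus j" and "spectral j"
    and "{a..b} \<in> nucleus_intervals (neg_nucleus j)"
  shows "(\<forall>x. a \<le> x \<and> x \<le> b \<longrightarrow>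
      (\<exists>y. a \<le> y \<and> y \<le> b \<and> inf x y = a \<and> sup x y = b)) \<and>
    (\<exists>y\<in>{a..b}. {y..b} \<in> Sct j)"
proof -
  have ab: "a \<le> b" "b \<le> neg_nucleus j a"
    using assms(3) by (simp_all add: atLeastAtMost_in_nucleus_intervals_iff)
  show ?thesis
  proof (intro conjI allI impI)
    fix x
    assume "a \<le> x \<and> x \<le> b"
    then show "\<exists>y. a \<le> y \<and> y \<le> b \<and> inf x y = a \<and> sup x y = b"
      using spectral_interval_complemented[OF assms(2) neg_nucleus_disjoint[OF assms(1)] ab(2)]
      by blast
  next
    show "\<exists>y\<in>{a..b}. {y..b} \<in> Sct j"
      using ab(1) by (intro bexI[of _ b] singleton_in_Sct) simp
  qed
qed

end
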